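(* Let $\Gamma$ be an arbitrary set and let $X$ be a closed linear subspace of $c_0(\Gamma)$. Then the dual space $X^*$ has the $1$-Schur property, i.e. for every bounded sequence $(x_k^* )$ in $X^*$ one has $\operatorname{ca}(x_k^* )\le \delta(x_k^* )$.
   Context: For a bounded sequence $(x_k)$ in a Banach space $Z$ define $\operatorname{ca}(x_k)=\inf_{n\in\mathbb N}\operatorname{diam}\{x_k:k\ge n\}$ (diameter in norm) and $\delta(x_k)=\sup_{z^*\in B_{Z^*}}\inf_{n\in\mathbb N}\operatorname{diam}\{z^*(x_k):k\ge n\}$. A Banach space $Z$ has the $C$-Schur property ($C\ge0$) if $\operatorname{ca}(x_k)\le C\,\delta(x_k)$ for every bounded sequence $(x_k)$ in $Z$. Here these quantities are applied with $Z=X^*$, so the supremum in $\delta$ runs over the unit ball of $X^{**}$. *)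

theory Defs
  imports "HOL-Analysis.Analysis"
begin

text \<open>Real Banach space c_0(Gamma) for an arbitrary set Gamma (elements are functions
  vanishing outside Gamma and vanishing at infinity), with the supremum norm.\<close>

definition c0 :: "'a set \<Rightarrow> ('a \<Rightarrow> real) set" where
  "c0 \<Gamma> = {f. (\<forall>\<gamma>. \<gamma> \<notin> \<Gamma> \<longrightarrow> f \<gamma> = 0) \<and> (\<forall>e>0. finite {\<gamma>. e \<le> \<bar>f \<gamma>\<bar>})}"

definition supnorm :: "('a \<Rightarrow> real) \<Rightarrow> real" where
  "supnorm f = (SUP \<gamma>. \<bar>f \<gamma>\<bar>)"

text \<open>X is a closed linear subspace of c_0(Gamma).\<close>
definition closed_subspace_c0 :: "'a set \<Rightarrow> ('a \<Rightarrow> real) set \<Rightarrow> bool" where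
  "closed_subspace_c0 \<Gamma> X \<longleftrightarrow>
     X \<subseteq> c0 \<Gamma> \<and> (\<lambda>_. 0) \<in> X \<and>
     (\<forall>x\<in>X. \<forall>y\<in>X. (\<lambda>\<gamma>. x \<gamma> + y \<gamma>) \<in> X) \<and>
     (\<forall>x\<in>X. \<forall>c. (\<lambda>\<gamma>. c * x \<gamma>) \<in> X) \<and>
     (\<forall>s f. (\<forall>n. s n \<in> X) \<longrightarrow> f \<in> c0 \<Gamma> \<longrightarrow>
        (\<lambda>n. supnorm (\<lambda>\<gamma>. s n \<gamma> - f \<gamma>)) \<longlonglongrightarrow> 0 \<longrightarrow> f \<in> X)"

text \<open>The dual space X^*: bounded linear functionals on X, normalised to be 0 outside X
  (so that each element of X^* has a unique representative).\<close>
definition dual_space :: "('a \<Rightarrow> real) set \<Rightarrow> (('a \<Rightarrow> real) \<Rightarrow> real) set" where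
  "dual_space X = {\<phi>. (\<forall>x. x \<notin> X \<longrightarrow> \<phi> x = 0) \<and>
     (\<forall>x\<in>X. \<forall>y\<in>X. \<phi> (\<lambda>\<gamma>. x \<gamma> + y \<gamma>) = \<phi> x + \<phi> y) \<and>
     (\<forall>x\<in>X. \<forall>c. \<phi> (\<lambda>\<gamma>. c * x \<gamma>) = c * \<phi> x) \<and>
     (\<exists>C. \<forall>x\<in>X. \<bar>\<phi> x\<bar> \<le> C * supnorm x)}"

definition dual_norm :: "('a \<Rightarrow> real) set \<Rightarrow> (('a \<Rightarrow> real) \<Rightarrow> real) \<Rightarrow> real" where
  "dual_norm X \<phi> = (SUP x\<in>{x\<in>X. supnorm x \<le> 1}. \<bar>\<phi> x\<bar>)"

text \<open>Unit ball of the bidual X^{**}: linear functionals on X^* of norm at most 1.\<close>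
definition bidual_ball :: "('a \<Rightarrow> real) set \<Rightarrow> ((('a \<Rightarrow> real) \<Rightarrow> real) \<Rightarrow> real) set" where
  "bidual_ball X = {\<Psi>.
     (\<forall>\<phi>\<in>dual_space X. \<forall>\<psi>\<in>dual_space X. \<Psi> (\<lambda>x. \<phi> x + \<psi> x) = \<Psi> \<phi> + \<Psi> \<psi>) \<and>
     (\<forall>\<phi>\<in>dual_space X. \<forall>c. \<Psi> (\<lambda>x. c * \<phi> x) = c * \<Psi> \<phi>) \<and>
     (\<forall>\<phi>\<in>dual_space X. \<bar>\<Psi> \<phi>\<bar> \<le> dual_norm X \<phi>)}"

text \<open>ca(x_k^*) = inf_n diam{x_k^* : k >= n} (diameter in the norm of X^*).\<close>
definition ca_dual :: "('a \<Rightarrow> real) set \<Rightarrow> (nat \<Rightarrow> ('a \<Rightarrow> real) \<Rightarrow> real) \<Rightarrow> real" where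
  "ca_dual X xs = (INF n. SUP p\<in>{(k, l). n \<le> k \<and> n \<le> l}.
       dual_norm X (\<lambda>x. xs (fst p) x - xs (snd p) x))"

text \<open>delta(x_k^*) = sup over the unit ball of X^{**} of inf_n diam{z(x_k^*) : k >= n}.\<close>
definition delta_dual :: "('a \<Rightarrow> real) set \<Rightarrow> (nat \<Rightarrow> ('a \<Rightarrow> real) \<Rightarrow> real) \<Rightarrow> real" where
  "delta_dual X xs = (SUP \<Psi>\<in>bidual_ball X. INF n. SUP p\<in>{(k, l). n \<le> k \<and> n \<le> l}.
       \<bar>\<Psi> (xs (fst p)) - \<Psi> (xs (snd p))\<bar>)"

end

theory Submission
  imports Defs "HOL-Library.Function_Algebras"
begin

text \<open>
  Weak-star limits are taken along a filter \<open>U\<close> on \<open>\<nat>\<close>, finer than the cofinite one, along which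
  every bounded real sequence converges, so no separability or subsequences are needed.

  If \<open>s \<in> X\<^sup>*\<close> and \<open>w\<^sub>n \<rightarrow> 0\<close> weak-star in \<open>X\<^sup>*\<close>, then \<open>\<parallel>s + w\<^sub>n\<parallel> - \<parallel>s\<parallel> - \<parallel>w\<^sub>n\<parallel> \<rightarrow> 0\<close>. Indeed, let
  \<open>G\<^sub>n\<close> be a norm-preserving extension of \<open>s + w\<^sub>n\<close> to \<open>c\<^sub>0\<close> and \<open>H\<close> the limit of \<open>G\<^sub>n\<close>. In
  \<open>\<ell>\<^sub>1 = c\<^sub>0\<^sup>*\<close> the norm is asymptotically additive, \<open>\<parallel>G\<^sub>n\<parallel> \<approx> \<parallel>H\<parallel> + \<parallel>G\<^sub>n - H\<parallel>\<close>, while \<open>H\<close> extends \<open>s\<close>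
  and \<open>G\<^sub>n - H\<close> extends \<open>w\<^sub>n\<close>.

  Given differences \<open>d\<^sub>n = x\<^sup>*\<^bsub>k(n)\<^esub> - x\<^sup>*\<^bsub>l(n)\<^esub>\<close> of norm at least \<open>c\<close> with limit \<open>h\<close>, put \<open>w\<^sub>n = d\<^sub>n - h\<close>.
  Inductively one selects indices for which the norm of \<open>h\<close> plus the selected \<open>w\<^sub>n\<close> is, up to \<open>\<epsilon>\<close>, the
  sum of the norms. A vector of the unit ball of \<open>X\<close> almost norming such a partial sum almost norms
  every summand, hence is at least \<open>c - 2\<epsilon>\<close> on each selected \<open>d\<^sub>n\<close>; a limit of these vectors in the
  bidual ball witnesses \<open>\<delta> \<ge> c - 2\<epsilon>\<close>.
\<close>

section \<open>Pointwise vector space structure on functions and functionals\<close>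

instantiation "fun" :: (type, real_vector) real_vector
begin

definition scaleR_fun :: "real \<Rightarrow> ('a \<Rightarrow> 'b) \<Rightarrow> 'a \<Rightarrow> 'b"
  where "scaleR_fun r f = (\<lambda>x. r *\<^sub>R f x)"

instance
  by standard (simp_all add: scaleR_fun_def fun_eq_iff scaleR_add_right scaleR_add_left)

end

lemma scaleR_fun_apply [simp]: "(r *\<^sub>R f) x = r *\<^sub>R f x"
  by (simp add: scaleR_fun_def)

section \<open>The Hahn--Banach theorem\<close>

text \<open>Positive homogeneity is required only as an inequality for \<open>t > 0\<close>: the
  same inequality for \<open>1 / t\<close> reverses it, and \<open>q 0 = 0\<close> covers
  \<open>t = 0\<close>.\<close>

definition sublinear_on :: "'v::real_vector set \<Rightarrow> ('v \<Rightarrow> real) \<Rightarrow> bool" where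
  "sublinear_on V q \<longleftrightarrow> q 0 = 0 \<and> (\<forall>x\<in>V. \<forall>y\<in>V. q (x + y) \<le> q x + q y) \<and>
     (\<forall>x\<in>V. \<forall>t>0. q (t *\<^sub>R x) \<le> t * q x)"

lemma sublinear_onD:
  assumes "sublinear_on V q"
  shows "q 0 = 0" "x \<in> V \<Longrightarrow> y \<in> V \<Longrightarrow> q (x + y) \<le> q x + q y"
    "x \<in> V \<Longrightarrow> t > 0 \<Longrightarrow> q (t *\<^sub>R x) \<le> t * q x"
  using assms by (auto simp: sublinear_on_def)

lemma sublinear_on_scaleR:
  assumes V: "subspace V" and q: "sublinear_on V q" and x: "x \<in> V" and t: "t \<ge> 0"
  shows "q (t *\<^sub>R x) = t * q x"
proof (cases "t = 0")
  case True
  then show ?thesis using q by (simp add: sublinear_on_def)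
next
  case False
  then have t: "t > 0" using t by simp
  have "q ((1 / t) *\<^sub>R (t *\<^sub>R x)) \<le> (1 / t) * q (t *\<^sub>R x)"
    using sublinear_onD(3)[OF q subspace_scale[OF V x], of "1 / t" t] t by simp
  then have "q x \<le> (1 / t) * q (t *\<^sub>R x)" using t by simp
  then have "t * q x \<le> q (t *\<^sub>R x)" using t by (simp add: field_simps)
  with sublinear_onD(3)[OF q x t] show ?thesis by simp
qed

text \<open>Subadditivity for \<open>z = (x + z) + (- x)\<close>. This bound keeps the infima below
  finite.\<close>

lemma sublinear_on_lower:
  assumes V: "subspace V" and q: "sublinear_on V q" and x: "x \<in> V" and z: "z \<in> V"
  shows "q z - q (- x) \<le> q (x + z)"
  using sublinear_onD(2)[OF q subspace_add[OF V x z] subspace_neg[OF V x]] by simp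

text \<open>Infimal convolution of \<open>q\<close> with the function sending \<open>- k\<close> to
  \<open>- g k\<close>, for \<open>k\<close> in \<open>K\<close>. With \<open>K\<close> a ray it
  shows that minimal sublinear functions are additive; with \<open>K\<close> a subspace it forces
  linear minorants to extend \<open>g\<close>.\<close>

definition inf_conv :: "'v::real_vector set \<Rightarrow> ('v \<Rightarrow> real) \<Rightarrow> ('v \<Rightarrow> real) \<Rightarrow> 'v \<Rightarrow> real" where
  "inf_conv K g q x = (INF k\<in>K. q (x + k) - g k)"

text \<open>\<open>K\<close> is only a convex cone, which covers rays and subspaces alike.
  Competitors for \<open>x\<close> and \<open>y\<close> add up to one for \<open>x + y\<close> and
  scale with \<open>x\<close>; \<open>g \<le> q\<close> on \<open>K\<close> bounds the infimum from
  below.\<close>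

lemma sublinear_inf_conv:
  assumes V: "subspace V" and q: "sublinear_on V q" and KV: "K \<subseteq> V" and K0: "0 \<in> K"
    and Kadd: "\<And>k l. k \<in> K \<Longrightarrow> l \<in> K \<Longrightarrow> k + l \<in> K"
    and Kscale: "\<And>k t. k \<in> K \<Longrightarrow> t > 0 \<Longrightarrow> t *\<^sub>R k \<in> K"
    and gadd: "\<And>k l. k \<in> K \<Longrightarrow> l \<in> K \<Longrightarrow> g (k + l) = g k + g l"
    and gscale: "\<And>k t. k \<in> K \<Longrightarrow> t > 0 \<Longrightarrow> g (t *\<^sub>R k) = t * g k"
    and gq: "\<And>k. k \<in> K \<Longrightarrow> g k \<le> q k"
  shows "sublinear_on V (inf_conv K g q)"
    and "\<And>x k. x \<in> V \<Longrightarrow> k \<in> K \<Longrightarrow> inf_conv K g q x \<le> q (x + k) - g k"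
proof -
  have bdd: "bdd_below ((\<lambda>k. q (x + k) - g k) ` K)" if "x \<in> V" for x
  proof (rule bdd_belowI2)
    fix k assume "k \<in> K"
    then show "- q (- x) \<le> q (x + k) - g k"
      using sublinear_on_lower[OF V q that, of k] gq[of k] KV by auto
  qed
  show upper: "inf_conv K g q x \<le> q (x + k) - g k" if "x \<in> V" "k \<in> K" for x k
    unfolding inf_conv_def using bdd[OF that(1)] that(2) by (rule cINF_lower)
  have ne: "K \<noteq> {}" using K0 by auto
  have "inf_conv K g q 0 = 0"
  proof (rule antisym)
    have "g 0 = 0" using gadd[OF K0 K0] by simp
    then show "inf_conv K g q 0 \<le> 0"
      using upper[OF subspace_0[OF V] K0] sublinear_onD(1)[OF q] by simp
    show "0 \<le> inf_conv K g q 0"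
      unfolding inf_conv_def using gq by (intro cINF_greatest ne) simp
  qed
  moreover have "inf_conv K g q (x + y) \<le> inf_conv K g q x + inf_conv K g q y"
    if "x \<in> V" "y \<in> V" for x y
  proof -
    have *: "inf_conv K g q (x + y) \<le> (q (x + k) - g k) + (q (y + l) - g l)"
      if kl: "k \<in> K" "l \<in> K" for k l
    proof -
      have "inf_conv K g q (x + y) \<le> q ((x + y) + (k + l)) - g (k + l)"
        using upper[OF subspace_add[OF V \<open>x \<in> V\<close> \<open>y \<in> V\<close>] Kadd[OF kl]] .
      also have "(x + y) + (k + l) = (x + k) + (y + l)" by simp
      also have "q \<dots> \<le> q (x + k) + q (y + l)"
        using that kl KV \<open>x \<in> V\<close> \<open>y \<in> V\<close>
        by (intro sublinear_onD(2)[OF q]) (auto intro: subspace_add[OF V])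
      finally show ?thesis using gadd[OF kl] by simp
    qed
    have "inf_conv K g q (x + y) - (q (x + k) - g k) \<le> inf_conv K g q y" if "k \<in> K" for k
      unfolding inf_conv_def[of K g q y]
    proof (rule cINF_greatest[OF ne])
      fix l assume "l \<in> K"
      then show "inf_conv K g q (x + y) - (q (x + k) - g k) \<le> q (y + l) - g l"
        using *[OF that] by force
    qed
    then have "inf_conv K g q (x + y) - inf_conv K g q y \<le> q (x + k) - g k" if "k \<in> K" for k
      using that by force
    then have "inf_conv K g q (x + y) - inf_conv K g q y \<le> inf_conv K g q x"
      unfolding inf_conv_def[of K g q x] by (intro cINF_greatest[OF ne])
    then show ?thesis by simp
  qed
  moreover have "inf_conv K g q (t *\<^sub>R x) \<le> t * inf_conv K g q x" if "x \<in> V" "t > 0" for x t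
  proof -
    have "inf_conv K g q (t *\<^sub>R x) / t \<le> q (x + k) - g k" if k: "k \<in> K" for k
    proof -
      have "inf_conv K g q (t *\<^sub>R x) \<le> q (t *\<^sub>R x + t *\<^sub>R k) - g (t *\<^sub>R k)"
        using upper[OF subspace_scale[OF V \<open>x \<in> V\<close>] Kscale[OF k \<open>t > 0\<close>]] .
      also have "t *\<^sub>R x + t *\<^sub>R k = t *\<^sub>R (x + k)" by (simp add: scaleR_add_right)
      also have "q \<dots> = t * q (x + k)"
        using k KV \<open>x \<in> V\<close> \<open>t > 0\<close>
        by (intro sublinear_on_scaleR[OF V q]) (auto intro: subspace_add[OF V])
      finally show ?thesis using gscale[OF k \<open>t > 0\<close>] \<open>t > 0\<close> by (simp add: field_simps)
    qed
    then have "inf_conv K g q (t *\<^sub>R x) / t \<le> inf_conv K g q x"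
      unfolding inf_conv_def[of K g q x] by (intro cINF_greatest[OF ne])
    then show ?thesis using \<open>t > 0\<close> by (simp add: field_simps)
  qed
  ultimately show "sublinear_on V (inf_conv K g q)" by (simp add: sublinear_on_def)
qed

text \<open>Zorn's lemma for the reversed pointwise order: the infimum of a chain is again
  sublinear, and it is finite because \<open>q x \<ge> - p (- x)\<close> throughout the
  chain.\<close>

lemma minimal_sublinear_exists:
  fixes V :: "'v::real_vector set"
  assumes V: "subspace V" and p: "sublinear_on V p"
  obtains q where "sublinear_on V q" "\<And>x. x \<in> V \<Longrightarrow> q x \<le> p x"
    "\<And>r x. sublinear_on V r \<Longrightarrow> (\<And>x. x \<in> V \<Longrightarrow> r x \<le> q x) \<Longrightarrow> x \<in> V \<Longrightarrow> r x = q x"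
proof -
  \<comment> \<open>Members of the Zorn family vanish outside \<open>V\<close>, so that infima of
    chains are controlled there too; \<open>trunc\<close> brings any sublinear function into this
    form.\<close>
  define trunc where "trunc r = (\<lambda>x. if x \<in> V then r x else 0)" for r :: "'v \<Rightarrow> real"
  have trunc: "sublinear_on V (trunc r)" if "sublinear_on V r" for r
    using that subspace_0[OF V] subspace_add[OF V] subspace_scale[OF V]
    by (auto simp: sublinear_on_def trunc_def)
  define A where "A = {q. sublinear_on V q \<and> (\<forall>x\<in>V. q x \<le> p x) \<and> (\<forall>x. x \<notin> V \<longrightarrow> q x = 0)}"
  have "\<exists>m\<in>A. \<forall>a\<in>A. m \<ge> a \<longrightarrow> a = m"
  proof (rule predicate_Zorn)
    show "partial_order_on A (relation_of (\<ge>) A)"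
      by (auto simp: partial_order_on_def preorder_on_def refl_on_def trans_def antisym_def
          relation_of_def)
    fix C assume C: "C \<in> Chains (relation_of (\<ge>) A)"
    show "\<exists>u\<in>A. \<forall>a\<in>C. a \<ge> u"
    proof (cases "C = {}")
      case True
      have "trunc p \<in> A" using trunc[OF p] by (auto simp: A_def trunc_def)
      then show ?thesis using True by auto
    next
      case False
      have CA: "C \<subseteq> A" and Ctot: "\<And>a b. a \<in> C \<Longrightarrow> b \<in> C \<Longrightarrow> a \<le> b \<or> b \<le> a"
        using C by (auto simp: Chains_def relation_of_def)
      define u where "u x = (INF q\<in>C. q x)" for x
      have bdd: "bdd_below ((\<lambda>q. q x) ` C)" for x
      proof (cases "x \<in> V")
        case True
        show ?thesis
        proof (rule bdd_belowI2)
          fix q assume "q \<in> C"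
          then have q: "sublinear_on V q" "q (- x) \<le> p (- x)"
            using CA subspace_neg[OF V True] by (auto simp: A_def)
          show "- p (- x) \<le> q x"
            using sublinear_on_lower[OF V q(1) True subspace_0[OF V]] q
              sublinear_onD(1)[OF q(1)] by simp
        qed
      next
        case False
        then show ?thesis using CA by (intro bdd_belowI2[of _ 0]) (auto simp: A_def)
      qed
      have lower: "u x \<le> q x" if "q \<in> C" for q x
        unfolding u_def using bdd that by (rule cINF_lower)
      have "u 0 = 0"
      proof -
        have "(\<lambda>q. q 0) ` C = {0}" using False CA by (force simp: A_def sublinear_on_def image_iff)
        then show ?thesis unfolding u_def by simp
      qed
      moreover have "u (x + y) \<le> u x + u y" if "x \<in> V" "y \<in> V" for x y
      proof -
        \<comment> \<open>The two infima on the right run over different members of the chain; the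
          smaller of \<open>q\<close> and \<open>r\<close> serves for both.\<close>
        have *: "u (x + y) \<le> q x + r y" if qr: "q \<in> C" "r \<in> C" for q r
        proof -
          obtain s where s: "s \<in> C" "s \<le> q" "s \<le> r" using Ctot[OF qr] qr by blast
          have "u (x + y) \<le> s (x + y)" using lower s by blast
          also have "\<dots> \<le> s x + s y"
            using s(1) CA \<open>x \<in> V\<close> \<open>y \<in> V\<close> by (auto simp: A_def sublinear_on_def)
          also have "\<dots> \<le> q x + r y" using s by (intro add_mono) (auto simp: le_fun_def)
          finally show ?thesis .
        qed
        have "u (x + y) - q x \<le> u y" if "q \<in> C" for q
          unfolding u_def[of y] using *[OF that] by (intro cINF_greatest False) force
        then have "u (x + y) - u y \<le> u x"
          unfolding u_def[of x] by (intro cINF_greatest False) force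
        then show ?thesis by simp
      qed
      moreover have "u (t *\<^sub>R x) \<le> t * u x" if "x \<in> V" "t > 0" for x t
      proof -
        have "u (t *\<^sub>R x) / t \<le> q x" if q: "q \<in> C" for q
        proof -
          have "u (t *\<^sub>R x) \<le> q (t *\<^sub>R x)" using lower[OF q] .
          also have "\<dots> \<le> t * q x"
            using q CA \<open>x \<in> V\<close> \<open>t > 0\<close> by (auto simp: A_def sublinear_on_def)
          finally show ?thesis using \<open>t > 0\<close> by (simp add: field_simps)
        qed
        then have "u (t *\<^sub>R x) / t \<le> u x"
          unfolding u_def[of x] by (intro cINF_greatest False)
        then show ?thesis using \<open>t > 0\<close> by (simp add: field_simps)
      qed
      ultimately have "sublinear_on V u" by (simp add: sublinear_on_def)
      moreover have "u x \<le> p x" if "x \<in> V" for x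
        using False lower[of _ x] CA that by (force simp: A_def)
      moreover have "u x = 0" if "x \<notin> V" for x
      proof -
        have "(\<lambda>q. q x) ` C = {0}" using False CA that by (force simp: A_def image_iff)
        then show ?thesis unfolding u_def by simp
      qed
      ultimately have "u \<in> A" by (simp add: A_def)
      then show ?thesis using lower by (auto simp: le_fun_def)
    qed
  qed
  then obtain m where m: "m \<in> A" and min: "\<And>a. a \<in> A \<Longrightarrow> a \<le> m \<Longrightarrow> a = m" by blast
  show thesis
  proof (rule that[of m])
    show "sublinear_on V m" "\<And>x. x \<in> V \<Longrightarrow> m x \<le> p x" using m by (auto simp: A_def)
    fix r x assume r: "sublinear_on V r" "\<And>x. x \<in> V \<Longrightarrow> r x \<le> m x" and x: "x \<in> V"
    have "trunc r \<in> A" using trunc[OF r(1)] r(2) m by (force simp: A_def trunc_def)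
    moreover have "trunc r \<le> m" using r(2) m by (auto simp: A_def trunc_def le_fun_def)
    ultimately have "trunc r = m" by (rule min)
    then show "r x = m x" using x by (auto simp: trunc_def)
  qed
qed

text \<open>A minimal sublinear function is additive, hence linear: negative scalars follow from
  additivity at \<open>c *\<^sub>R x\<close> and its negative.\<close>

lemma linear_below_sublinear:
  fixes V :: "'v::real_vector set"
  assumes V: "subspace V" and p: "sublinear_on V p"
  obtains F where "\<And>x y. x \<in> V \<Longrightarrow> y \<in> V \<Longrightarrow> F (x + y) = F x + F y"
    "\<And>x c. x \<in> V \<Longrightarrow> F (c *\<^sub>R x) = c * F x" "\<And>x. x \<in> V \<Longrightarrow> F x \<le> p x"
proof -
  obtain q where q: "sublinear_on V q" and qp: "\<And>x. x \<in> V \<Longrightarrow> q x \<le> p x"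
    and min: "\<And>r x. sublinear_on V r \<Longrightarrow> (\<And>x. x \<in> V \<Longrightarrow> r x \<le> q x) \<Longrightarrow> x \<in> V \<Longrightarrow> r x = q x"
    using minimal_sublinear_exists[OF V p] by blast
  have add: "q (x + a) = q x + q a" if x: "x \<in> V" and a: "a \<in> V" for x a
  proof -
    \<comment> \<open>Infimal convolution along the ray through \<open>a\<close> lies below \<open>q\<close>, so it equals \<open>q\<close> by minimality.\<close>
    define K where "K = {t *\<^sub>R a | t. t \<ge> 0}"
    note scale = sublinear_on_scaleR[OF V q a]
    have K0: "0 \<in> K" and aK: "a \<in> K" unfolding K_def by (auto intro: exI[of _ 0] exI[of _ 1])
    have KV: "K \<subseteq> V" unfolding K_def using subspace_scale[OF V a] by auto
    have K: "k + l \<in> K \<and> q (k + l) = q k + q l" if "k \<in> K" "l \<in> K" for k l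
      using that unfolding K_def by (force simp: scaleR_add_left[symmetric] scale distrib_right)
    have K': "t *\<^sub>R k \<in> K \<and> q (t *\<^sub>R k) = t * q k" if "k \<in> K" "t > 0" for k t
      using that unfolding K_def by (force simp: scale)
    have conv: "sublinear_on V (inf_conv K q q)"
      "\<And>x k. x \<in> V \<Longrightarrow> k \<in> K \<Longrightarrow> inf_conv K q q x \<le> q (x + k) - q k"
      using sublinear_inf_conv[OF V q KV K0, of q] K K' by blast+
    have "inf_conv K q q x = q x"
    proof (rule min[OF conv(1) _ x])
      fix x assume "x \<in> V"
      then show "inf_conv K q q x \<le> q x"
        using conv(2)[OF _ K0, of x] sublinear_onD(1)[OF q] by simp
    qed
    then have "q x \<le> q (x + a) - q a" using conv(2)[OF x aK] by simp
    then show ?thesis using sublinear_onD(2)[OF q x a] by simp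
  qed
  show thesis
  proof (rule that[OF add _ qp])
    fix x and c :: real assume x: "x \<in> V"
    show "q (c *\<^sub>R x) = c * q x"
    proof (cases "c \<ge> 0")
      case True
      then show ?thesis using sublinear_on_scaleR[OF V q x] by simp
    next
      case False
      have "q (c *\<^sub>R x) + q ((- c) *\<^sub>R x) = q (c *\<^sub>R x + (- c) *\<^sub>R x)"
        by (intro add[symmetric] subspace_scale[OF V x])
      also have "\<dots> = 0" using sublinear_onD(1)[OF q] by simp
      finally show ?thesis using sublinear_on_scaleR[OF V q x, of "- c"] False by simp
    qed
  qed
qed

text \<open>A linear \<open>F\<close> below \<open>inf_conv S f p\<close> is below \<open>p\<close>
  (take \<open>k = 0\<close>) and, on \<open>S\<close>, below \<open>f\<close> (take
  \<open>k = - x\<close>). Applying the latter to \<open>x\<close> and \<open>- x\<close> gives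
  equality on \<open>S\<close>.\<close>

theorem Hahn_Banach_on:
  fixes V :: "'v::real_vector set"
  assumes V: "subspace V" and S: "subspace S" and SV: "S \<subseteq> V" and p: "sublinear_on V p"
    and fadd: "\<And>x y. x \<in> S \<Longrightarrow> y \<in> S \<Longrightarrow> f (x + y) = f x + f y"
    and fscale: "\<And>x c. x \<in> S \<Longrightarrow> f (c *\<^sub>R x) = c * f x"
    and fp: "\<And>x. x \<in> S \<Longrightarrow> f x \<le> p x"
  obtains F where "\<And>x y. x \<in> V \<Longrightarrow> y \<in> V \<Longrightarrow> F (x + y) = F x + F y"
    "\<And>x c. x \<in> V \<Longrightarrow> F (c *\<^sub>R x) = c * F x" "\<And>x. x \<in> V \<Longrightarrow> F x \<le> p x"
    "\<And>x. x \<in> S \<Longrightarrow> F x = f x"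
proof -
  have conv: "sublinear_on V (inf_conv S f p)"
    "\<And>x k. x \<in> V \<Longrightarrow> k \<in> S \<Longrightarrow> inf_conv S f p x \<le> p (x + k) - f k"
    using sublinear_inf_conv[OF V p SV subspace_0[OF S] subspace_add[OF S] subspace_scale[OF S]
        fadd fscale fp] by blast+
  obtain F where F: "\<And>x y. x \<in> V \<Longrightarrow> y \<in> V \<Longrightarrow> F (x + y) = F x + F y"
    "\<And>x c. x \<in> V \<Longrightarrow> F (c *\<^sub>R x) = c * F x" "\<And>x. x \<in> V \<Longrightarrow> F x \<le> inf_conv S f p x"
    using linear_below_sublinear[OF V conv(1)] by blast
  have f0: "f 0 = 0" using fscale[OF subspace_0[OF S], of 0] by simp
  have Ff: "F x \<le> f x" if "x \<in> S" for x
  proof -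
    have "F x \<le> p (x + - x) - f (- x)"
      using F(3)[of x] conv(2)[OF _ subspace_neg[OF S that], of x] that SV by force
    moreover have "f (- x) = - f x" using fscale[OF that, of "- 1"] by simp
    ultimately show ?thesis using sublinear_onD(1)[OF p] by simp
  qed
  show thesis
  proof (rule that[OF F(1,2)])
    show "F x \<le> p x" if "x \<in> V" for x
      using F(3)[OF that] conv(2)[OF that subspace_0[OF S]] f0 by simp
    show "F x = f x" if "x \<in> S" for x
      using Ff[OF that] Ff[OF subspace_neg[OF S that]] F(2)[of x "- 1"] fscale[OF that, of "- 1"]
        that SV by auto
  qed
qed

section \<open>Limits of bounded sequences along a filter\<close>

text \<open>Stands in for a free ultrafilter: one filter assigns limits to all bounded sequences
  simultaneously.\<close>

definition bounded_limit_filter :: "nat filter \<Rightarrow> bool" where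
  "bounded_limit_filter U \<longleftrightarrow> U \<noteq> bot \<and> U \<le> sequentially \<and>
     (\<forall>f :: nat \<Rightarrow> real. bounded (range f) \<longrightarrow> (\<exists>l. (f \<longlongrightarrow> l) U))"

text \<open>By Tychonoff's theorem the evaluations \<open>e n\<close>, as points of a product of
  compact sets indexed by all sequences, have a cluster point \<open>L\<close>.\<close>

lemma exists_bounded_limit_filter: "\<exists>U. bounded_limit_filter U"
proof -
  \<comment> \<open>Coordinates belonging to unbounded sequences are collapsed to 0, so that every
    factor is compact.\<close>
  define S :: "(nat \<Rightarrow> real) \<Rightarrow> real set"
    where "S f = (if bounded (range f) then closure (range f) else {0})" for f
  define e :: "nat \<Rightarrow> (nat \<Rightarrow> real) \<Rightarrow> real"
    where "e n f = (if bounded (range f) then f n else 0)" for n f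
  have "compactin (product_topology (\<lambda>_. euclidean) UNIV) (PiE UNIV S)"
    by (auto simp: compactin_PiE S_def compact_closure)
  then have "compact (PiE UNIV S)" by (simp add: euclidean_product_topology)
  moreover have "eventually (\<lambda>x. x \<in> PiE UNIV S) (filtermap e sequentially)"
    by (auto simp: eventually_filtermap e_def S_def PiE_iff
        intro!: always_eventually closure_subset[THEN subsetD])
  moreover have "filtermap e sequentially \<noteq> bot" by (simp add: filtermap_bot_iff)
  ultimately obtain L where L: "inf (nhds L) (filtermap e sequentially) \<noteq> bot"
    unfolding compact_filter by blast
  \<comment> \<open>Tails together with preimages of neighbourhoods of \<open>L\<close>: along
    \<open>U\<close> the points \<open>e n\<close> tend to \<open>L\<close>, which coordinatewise is
    convergence of each bounded sequence. That \<open>L\<close> is a cluster point makes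
    \<open>U\<close> proper.\<close>
  define U where "U = inf sequentially (filtercomap e (nhds L))"
  show ?thesis
    unfolding bounded_limit_filter_def
  proof (intro exI[of _ U] conjI allI impI)
    show "U \<noteq> bot"
    proof
      assume "U = bot"
      then have "eventually (\<lambda>_. False) U" by simp
      then obtain P Q where P: "eventually P sequentially" and Q: "eventually Q (nhds L)"
        and PQ: "\<And>n. P n \<Longrightarrow> Q (e n) \<Longrightarrow> False"
        unfolding U_def eventually_inf eventually_filtercomap by blast
      have "eventually (\<lambda>x. \<not> Q x) (filtermap e sequentially)"
        unfolding eventually_filtermap using P by eventually_elim (use PQ in auto)
      with Q have "eventually (\<lambda>_. False) (inf (nhds L) (filtermap e sequentially))"
        unfolding eventually_inf by blast
      with L show False by (simp add: trivial_limit_def)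
    qed
    show "U \<le> sequentially" by (simp add: U_def)
    fix f :: "nat \<Rightarrow> real" assume f: "bounded (range f)"
    have "filterlim e (nhds L) U"
      unfolding U_def filterlim_def by (meson filtermap_filtercomap filtermap_mono inf_le2 order_trans)
    then have "((\<lambda>n. e n f) \<longlongrightarrow> L f) U"
      using continuous_on_tendsto_compose[OF continuous_on_product_coordinates[of f]] by simp
    then show "\<exists>l. (f \<longlongrightarrow> l) U" using f by (auto simp: e_def)
  qed
qed

lemma tendsto_abs_le:
  fixes f :: "nat \<Rightarrow> real"
  assumes "U \<noteq> bot" "(f \<longlongrightarrow> l) U" "\<And>n. \<bar>f n\<bar> \<le> c"
  shows "\<bar>l\<bar> \<le> c"
  using tendsto_upperbound[OF tendsto_rabs[OF assms(2)] always_eventually assms(1)] assms(3) by simp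

section \<open>Subspaces of the space c0 and their duals\<close>

lemma sum_fun_apply: "(\<Sum>i\<in>I. f i) x = (\<Sum>i\<in>I. f i x)"
  by (induction I rule: infinite_finite_induct) auto

section \<open>The supremum norm on c0\<close>

lemma c0_mono: "\<Gamma> \<subseteq> \<Delta> \<Longrightarrow> c0 \<Gamma> \<subseteq> c0 \<Delta>"
  by (auto simp: c0_def)

text \<open>Only finitely many entries have absolute value at least 1; all others lie in the unit
  interval.\<close>

lemma bdd_above_c0:
  assumes "x \<in> c0 \<Gamma>"
  shows "bdd_above (range (\<lambda>\<gamma>. \<bar>x \<gamma>\<bar>))"
proof -
  have "finite {\<gamma>. 1 \<le> \<bar>x \<gamma>\<bar>}" using assms by (simp add: c0_def)
  then have "bdd_above ((\<lambda>\<gamma>. \<bar>x \<gamma>\<bar>) ` {\<gamma>. 1 \<le> \<bar>x \<gamma>\<bar>})" by simp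
  then have "bdd_above ((\<lambda>\<gamma>. \<bar>x \<gamma>\<bar>) ` {\<gamma>. 1 \<le> \<bar>x \<gamma>\<bar>} \<union> {0..1})" by simp
  then show ?thesis by (rule bdd_above_mono) force
qed

lemma abs_le_supnorm: "x \<in> c0 \<Gamma> \<Longrightarrow> \<bar>x \<gamma>\<bar> \<le> supnorm x"
  unfolding supnorm_def by (rule cSUP_upper[OF UNIV_I bdd_above_c0])

lemma supnorm_le: "(\<And>\<gamma>. \<bar>x \<gamma>\<bar> \<le> c) \<Longrightarrow> supnorm x \<le> c"
  unfolding supnorm_def by (rule cSUP_least) auto

lemma supnorm_nonneg: "x \<in> c0 \<Gamma> \<Longrightarrow> 0 \<le> supnorm x"
  using abs_le_supnorm[of x \<Gamma>] by (meson abs_ge_zero order_trans)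

lemma subspace_c0: "subspace (c0 \<Gamma>)"
proof -
  have "finite {\<gamma>. e \<le> \<bar>x \<gamma> + y \<gamma>\<bar>}"
    if fin: "\<And>e. e > 0 \<Longrightarrow> finite {\<gamma>. e \<le> \<bar>x \<gamma>\<bar>}" "\<And>e. e > 0 \<Longrightarrow> finite {\<gamma>. e \<le> \<bar>y \<gamma>\<bar>}"
      and "e > 0" for x y :: "'a \<Rightarrow> real" and e
  proof (rule finite_subset)
    show "{\<gamma>. e \<le> \<bar>x \<gamma> + y \<gamma>\<bar>} \<subseteq> {\<gamma>. e / 2 \<le> \<bar>x \<gamma>\<bar>} \<union> {\<gamma>. e / 2 \<le> \<bar>y \<gamma>\<bar>}"
      by auto
    show "finite ({\<gamma>. e / 2 \<le> \<bar>x \<gamma>\<bar>} \<union> {\<gamma>. e / 2 \<le> \<bar>y \<gamma>\<bar>})"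
      using fin(1)[of "e / 2"] fin(2)[of "e / 2"] \<open>e > 0\<close> by simp
  qed
  moreover have "finite {\<gamma>. e \<le> \<bar>c * x \<gamma>\<bar>}"
    if fin: "\<And>e. e > 0 \<Longrightarrow> finite {\<gamma>. e \<le> \<bar>x \<gamma>\<bar>}" and "e > 0" for x :: "'a \<Rightarrow> real" and e c
  proof (cases "c = 0")
    case True
    then show ?thesis using \<open>e > 0\<close> by simp
  next
    case False
    then show ?thesis using fin[of "e / \<bar>c\<bar>"] \<open>e > 0\<close>
      by (simp add: abs_mult pos_divide_le_eq mult.commute)
  qed
  ultimately show ?thesis
    unfolding subspace_def c0_def by auto
qed

lemma supnorm_scaleR:
  assumes "x \<in> c0 \<Gamma>"
  shows "supnorm (t *\<^sub>R x) = \<bar>t\<bar> * supnorm x"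
proof -
  have le: "supnorm (t *\<^sub>R x) \<le> \<bar>t\<bar> * supnorm x" if "x \<in> c0 \<Gamma>" for x t
    using abs_le_supnorm[OF that] by (intro supnorm_le) (simp add: abs_mult mult_left_mono)
  show ?thesis
  proof (cases "t = 0")
    case True
    then show ?thesis by (simp add: supnorm_def)
  next
    case False
    then show ?thesis using le[OF assms, of t] le[OF subspace_scale[OF subspace_c0 assms], of "1 / t" t]
      by (simp add: field_simps)
  qed
qed

lemma supnorm_add_le:
  assumes "x \<in> c0 \<Gamma>" "y \<in> c0 \<Gamma>"
  shows "supnorm (x + y) \<le> supnorm x + supnorm y"
proof (rule supnorm_le)
  show "\<bar>(x + y) \<gamma>\<bar> \<le> supnorm x + supnorm y" for \<gamma>
    using abs_le_supnorm[OF assms(1), of \<gamma>] abs_le_supnorm[OF assms(2), of \<gamma>] by simp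
qed

lemma supnorm_zero [simp]: "supnorm 0 = 0"
  by (simp add: supnorm_def)

section \<open>Functionals on a subspace of c0 and their norm\<close>

lemma dual_spaceD:
  assumes "\<phi> \<in> dual_space X"
  shows "x \<notin> X \<Longrightarrow> \<phi> x = 0"
    and "x \<in> X \<Longrightarrow> y \<in> X \<Longrightarrow> \<phi> (x + y) = \<phi> x + \<phi> y"
    and "x \<in> X \<Longrightarrow> \<phi> (c *\<^sub>R x) = c * \<phi> x"
  using assms by (simp_all add: dual_space_def plus_fun_def scaleR_fun_def)

lemma dual_spaceI:
  assumes "\<And>x. x \<notin> X \<Longrightarrow> \<phi> x = 0"
    and "\<And>x y. x \<in> X \<Longrightarrow> y \<in> X \<Longrightarrow> \<phi> (x + y) = \<phi> x + \<phi> y"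
    and "\<And>x c. x \<in> X \<Longrightarrow> \<phi> (c *\<^sub>R x) = c * \<phi> x"
    and "\<And>x. x \<in> X \<Longrightarrow> \<bar>\<phi> x\<bar> \<le> C * supnorm x"
  shows "\<phi> \<in> dual_space X"
  using assms unfolding dual_space_def plus_fun_def scaleR_fun_def real_scaleR_def by blast

text \<open>Everything is placed inside \<open>c0 UNIV\<close>, which contains each
  \<open>c0 \<Gamma>\<close> with the same norm. The locale is also interpreted for
  \<open>c0 UNIV\<close> itself, where the extended functionals live.\<close>

locale c0_subspace =
  fixes X :: "('a \<Rightarrow> real) set"
  assumes subspace: "subspace X" and sub: "X \<subseteq> c0 UNIV"
begin

lemma in_c0: "x \<in> X \<Longrightarrow> x \<in> c0 UNIV"
  using sub by auto

lemma dual_norm_le: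
  "(\<And>x. x \<in> X \<Longrightarrow> supnorm x \<le> 1 \<Longrightarrow> \<bar>\<phi> x\<bar> \<le> c) \<Longrightarrow> dual_norm X \<phi> \<le> c"
  unfolding dual_norm_def using subspace_0[OF subspace] by (intro cSUP_least) force+

lemma bdd_above_dual:
  assumes "\<phi> \<in> dual_space X"
  shows "bdd_above ((\<lambda>x. \<bar>\<phi> x\<bar>) ` {x \<in> X. supnorm x \<le> 1})"
proof -
  obtain C where C: "\<And>x. x \<in> X \<Longrightarrow> \<bar>\<phi> x\<bar> \<le> C * supnorm x"
    using assms unfolding dual_space_def by blast
  show ?thesis
  proof (rule bdd_aboveI2)
    fix x assume x: "x \<in> {x \<in> X. supnorm x \<le> 1}"
    \<comment> \<open>The constant from \<open>dual_space\<close> carries no sign condition, hence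
      the absolute value.\<close>
    have "C * supnorm x \<le> \<bar>C\<bar> * supnorm x"
      using supnorm_nonneg[OF in_c0] x by (intro mult_right_mono) auto
    also have "\<dots> \<le> \<bar>C\<bar> * 1" using x by (intro mult_left_mono) auto
    finally show "\<bar>\<phi> x\<bar> \<le> \<bar>C\<bar>" using C[of x] x by simp
  qed
qed

lemma abs_le_dual_norm:
  assumes "\<phi> \<in> dual_space X" "x \<in> X" "supnorm x \<le> 1"
  shows "\<bar>\<phi> x\<bar> \<le> dual_norm X \<phi>"
  unfolding dual_norm_def using assms by (intro cSUP_upper bdd_above_dual) auto

lemma dual_norm_nonneg: "\<phi> \<in> dual_space X \<Longrightarrow> 0 \<le> dual_norm X \<phi>"
  using abs_le_dual_norm[OF _ subspace_0[OF subspace]] by force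

lemma abs_le_dual_norm_mult:
  assumes "\<phi> \<in> dual_space X" "x \<in> X" "supnorm x \<le> r" "r > 0"
  shows "\<bar>\<phi> x\<bar> \<le> dual_norm X \<phi> * r"
proof -
  have "supnorm ((1 / r) *\<^sub>R x) \<le> 1"
    unfolding supnorm_scaleR[OF in_c0[OF assms(2)]] using assms(3,4) by simp
  from abs_le_dual_norm[OF assms(1) subspace_scale[OF subspace assms(2)] this]
  show ?thesis
    using dual_spaceD(3)[OF assms(1,2), of "1 / r"] assms(4) by (simp add: abs_mult field_simps)
qed

lemma abs_le_dual_norm_supnorm:
  assumes "\<phi> \<in> dual_space X" "x \<in> X"
  shows "\<bar>\<phi> x\<bar> \<le> dual_norm X \<phi> * supnorm x"
proof (cases "supnorm x = 0")
  case True
  have "x \<gamma> = 0" for \<gamma> using abs_le_supnorm[OF in_c0[OF assms(2)], of \<gamma>] True by simp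
  then have "x = 0" by (auto simp: fun_eq_iff)
  then show ?thesis using dual_spaceD(3)[OF assms, of 0] True by simp
next
  case False
  then show ?thesis
    using abs_le_dual_norm_mult[OF assms order_refl] supnorm_nonneg[OF in_c0[OF assms(2)]] by simp
qed

text \<open>The norm is a supremum of absolute values; a sign change of the near-maximiser removes
  the absolute value.\<close>

lemma dual_norm_approx:
  assumes \<phi>: "\<phi> \<in> dual_space X" and "e > 0"
  obtains x where "x \<in> X" "supnorm x \<le> 1" "\<phi> x \<ge> dual_norm X \<phi> - e"
proof -
  have "dual_norm X \<phi> - e < (SUP x\<in>{x\<in>X. supnorm x \<le> 1}. \<bar>\<phi> x\<bar>)"
    using \<open>e > 0\<close> by (simp add: dual_norm_def)
  moreover have "{x\<in>X. supnorm x \<le> 1} \<noteq> {}" using subspace_0[OF subspace] by force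
  ultimately obtain x where x: "x \<in> X" "supnorm x \<le> 1" "dual_norm X \<phi> - e < \<bar>\<phi> x\<bar>"
    using less_cSUP_iff[OF _ bdd_above_dual[OF \<phi>]] by auto
  show thesis
  proof (cases "\<phi> x \<ge> 0")
    case True
    then show ?thesis using x that by force
  next
    case False
    show ?thesis
    proof (rule that)
      show "(- 1) *\<^sub>R x \<in> X" using subspace_scale[OF subspace x(1)] .
      show "supnorm ((- 1) *\<^sub>R x) \<le> 1" using supnorm_scaleR[OF in_c0[OF x(1)], of "- 1"] x by simp
      show "\<phi> ((- 1) *\<^sub>R x) \<ge> dual_norm X \<phi> - e"
        unfolding dual_spaceD(3)[OF \<phi> x(1)] using x False by simp
    qed
  qed
qed

lemma dual_space_add:
  assumes "\<phi> \<in> dual_space X" "\<psi> \<in> dual_space X"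
  shows "\<phi> + \<psi> \<in> dual_space X"
proof (rule dual_spaceI)
  show "\<bar>(\<phi> + \<psi>) x\<bar> \<le> (dual_norm X \<phi> + dual_norm X \<psi>) * supnorm x" if "x \<in> X" for x
    using abs_le_dual_norm_supnorm[OF assms(1) that] abs_le_dual_norm_supnorm[OF assms(2) that]
    by (simp add: distrib_right)
qed (simp_all add: dual_spaceD[OF assms(1)] dual_spaceD[OF assms(2)] distrib_left)

lemma dual_space_scaleR:
  assumes "\<phi> \<in> dual_space X"
  shows "c *\<^sub>R \<phi> \<in> dual_space X"
proof (rule dual_spaceI)
  show "\<bar>(c *\<^sub>R \<phi>) x\<bar> \<le> (\<bar>c\<bar> * dual_norm X \<phi>) * supnorm x" if "x \<in> X" for x
    using abs_le_dual_norm_supnorm[OF assms that]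
    by (simp add: abs_mult mult.assoc mult_left_mono)
qed (simp_all add: dual_spaceD[OF assms] distrib_left)

lemma dual_space_diff:
  assumes "\<phi> \<in> dual_space X" "\<psi> \<in> dual_space X"
  shows "\<phi> - \<psi> \<in> dual_space X"
  using dual_space_add[OF assms(1) dual_space_scaleR[OF assms(2), of "- 1"]] by simp

lemma dual_norm_add_le:
  assumes "\<phi> \<in> dual_space X" "\<psi> \<in> dual_space X"
  shows "dual_norm X (\<phi> + \<psi>) \<le> dual_norm X \<phi> + dual_norm X \<psi>"
proof (rule dual_norm_le)
  fix x assume x: "x \<in> X" "supnorm x \<le> 1"
  show "\<bar>(\<phi> + \<psi>) x\<bar> \<le> dual_norm X \<phi> + dual_norm X \<psi>"
    using abs_le_dual_norm[OF assms(1) x] abs_le_dual_norm[OF assms(2) x] by simp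
qed

lemma dual_norm_diff_le:
  assumes "\<phi> \<in> dual_space X" "\<psi> \<in> dual_space X"
  shows "dual_norm X (\<phi> - \<psi>) \<le> dual_norm X \<phi> + dual_norm X \<psi>"
proof (rule dual_norm_le)
  fix x assume x: "x \<in> X" "supnorm x \<le> 1"
  show "\<bar>(\<phi> - \<psi>) x\<bar> \<le> dual_norm X \<phi> + dual_norm X \<psi>"
    using abs_le_dual_norm[OF assms(1) x] abs_le_dual_norm[OF assms(2) x] by simp
qed

lemma dual_sum:
  assumes \<phi>: "\<phi> \<in> dual_space X" and "\<And>i. i \<in> I \<Longrightarrow> b i \<in> X"
  shows "\<phi> (\<Sum>i\<in>I. a i *\<^sub>R b i) = (\<Sum>i\<in>I. a i * \<phi> (b i))"
proof -
  have \<phi>0: "\<phi> 0 = 0" using dual_spaceD(3)[OF \<phi> subspace_0[OF subspace], of 0] by simp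
  show ?thesis
    using assms(2)
  proof (induction I rule: infinite_finite_induct)
    case (insert i I)
    have "(\<Sum>i\<in>I. a i *\<^sub>R b i) \<in> X"
      using insert by (intro subspace_sum[OF subspace] subspace_scale[OF subspace]) auto
    moreover have "b i \<in> X" using insert by simp
    ultimately have "\<phi> (a i *\<^sub>R b i + (\<Sum>i\<in>I. a i *\<^sub>R b i)) = a i * \<phi> (b i) + \<phi> (\<Sum>i\<in>I. a i *\<^sub>R b i)"
      by (simp only: dual_spaceD(2,3)[OF \<phi>] subspace_scale[OF subspace])
    moreover have "\<phi> (\<Sum>i\<in>I. a i *\<^sub>R b i) = (\<Sum>i\<in>I. a i * \<phi> (b i))"
      using insert.IH insert.prems by blast
    ultimately show ?case unfolding sum.insert[OF insert.hyps] by linarith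
  qed (use \<phi>0 in auto)
qed

section \<open>Norm-preserving extensions, weak-star limits and asymptotic additivity of the
  norm\<close>

lemma dual_extension:
  assumes \<phi>: "\<phi> \<in> dual_space X"
  obtains F where "F \<in> dual_space (c0 UNIV)" "dual_norm (c0 UNIV) F \<le> dual_norm X \<phi>"
    "\<And>x. x \<in> X \<Longrightarrow> F x = \<phi> x"
proof -
  let ?W = "c0 UNIV :: ('a \<Rightarrow> real) set"
  interpret W: c0_subspace ?W by unfold_locales (auto simp: subspace_c0)
  let ?p = "\<lambda>x. dual_norm X \<phi> * supnorm x"
  have p: "sublinear_on ?W ?p"
    unfolding sublinear_on_def
    using mult_left_mono[OF supnorm_add_le[where \<Gamma> = UNIV] dual_norm_nonneg[OF \<phi>]]
    by (auto simp: supnorm_scaleR[where \<Gamma> = UNIV] distrib_left)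
  have \<phi>p: "\<phi> x \<le> ?p x" if "x \<in> X" for x using abs_le_dual_norm_supnorm[OF \<phi> that] by linarith
  obtain F where F: "\<And>x y. x \<in> ?W \<Longrightarrow> y \<in> ?W \<Longrightarrow> F (x + y) = F x + F y"
    "\<And>x c. x \<in> ?W \<Longrightarrow> F (c *\<^sub>R x) = c * F x" "\<And>x. x \<in> ?W \<Longrightarrow> F x \<le> ?p x"
    "\<And>x. x \<in> X \<Longrightarrow> F x = \<phi> x"
    by (rule Hahn_Banach_on[OF subspace_c0 subspace sub p, where f = \<phi>])
      (use \<phi>p dual_spaceD(2,3)[OF \<phi>] in blast)+
  have bound: "\<bar>F x\<bar> \<le> ?p x" if "x \<in> ?W" for x
    using F(3)[OF that] F(3)[OF subspace_scale[OF subspace_c0 that, of "- 1"]]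
      F(2)[OF that, of "- 1"] supnorm_scaleR[OF that, of "- 1"] by simp
  \<comment> \<open>\<open>dual_space\<close> asks its members to vanish off the space, whereas
    Hahn-Banach leaves \<open>F\<close> free there.\<close>
  let ?G = "\<lambda>x. if x \<in> ?W then F x else 0"
  show thesis
  proof (rule that[of ?G])
    show "?G \<in> dual_space ?W"
      using F bound subspace_add[OF W.subspace] subspace_scale[OF W.subspace]
      by (intro dual_spaceI[where C = "dual_norm X \<phi>"]) auto
    show "dual_norm ?W ?G \<le> dual_norm X \<phi>"
    proof (rule W.dual_norm_le)
      fix x assume x: "x \<in> ?W" "supnorm x \<le> 1"
      then show "\<bar>?G x\<bar> \<le> dual_norm X \<phi>"
        using bound[OF x(1)] mult_left_mono[OF x(2) dual_norm_nonneg[OF \<phi>]] by simp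
    qed
    show "?G x = \<phi> x" if "x \<in> X" for x using F(4) in_c0 that by simp
  qed
qed

text \<open>Weak-star compactness in the style of Banach-Alaoglu: limits exist pointwise by
  boundedness, and linearity and the norm bound pass to the limit.\<close>

lemma dual_limit:
  assumes U: "bounded_limit_filter U"
    and \<phi>: "\<And>n. \<phi> n \<in> dual_space X" and C: "\<And>n. dual_norm X (\<phi> n) \<le> C"
  obtains \<psi> where "\<psi> \<in> dual_space X" "dual_norm X \<psi> \<le> C" "\<And>x. ((\<lambda>n. \<phi> n x) \<longlongrightarrow> \<psi> x) U"
proof -
  have ne: "U \<noteq> bot" using U by (simp add: bounded_limit_filter_def)
  have bound: "\<bar>\<phi> n x\<bar> \<le> C * supnorm x" if "x \<in> X" for n x
    using abs_le_dual_norm_supnorm[OF \<phi> that, of n]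
      mult_right_mono[OF C[of n] supnorm_nonneg[OF in_c0[OF that]]] by linarith
  have "\<exists>l. ((\<lambda>n. \<phi> n x) \<longlongrightarrow> l) U" for x
  proof (cases "x \<in> X")
    case True
    then have "bounded (range (\<lambda>n. \<phi> n x))" using bound by (auto simp: bounded_iff)
    then show ?thesis using U by (auto simp: bounded_limit_filter_def)
  next
    case False
    then show ?thesis using dual_spaceD(1)[OF \<phi> False] by (intro exI[of _ 0]) simp
  qed
  then obtain \<psi> where \<psi>: "\<And>x. ((\<lambda>n. \<phi> n x) \<longlongrightarrow> \<psi> x) U" by metis
  have \<psi>_bound: "\<bar>\<psi> x\<bar> \<le> C * supnorm x" if "x \<in> X" for x
    using tendsto_abs_le[OF ne \<psi> bound[OF that]] .
  show thesis
  proof (rule that[OF _ _ \<psi>])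
    show "\<psi> \<in> dual_space X"
    proof (rule dual_spaceI[OF _ _ _ \<psi>_bound])
      show "\<psi> x = 0" if "x \<notin> X" for x
        using tendsto_unique[OF ne \<psi>[of x], of 0] dual_spaceD(1)[OF \<phi> that] by simp
      show "\<psi> (x + y) = \<psi> x + \<psi> y" if "x \<in> X" "y \<in> X" for x y
        using tendsto_unique[OF ne \<psi>[of "x + y"]
            tendsto_add[OF \<psi>[of x] \<psi>[of y], folded dual_spaceD(2)[OF \<phi> that]]] .
      show "\<psi> (c *\<^sub>R x) = c * \<psi> x" if "x \<in> X" for x c
        using tendsto_unique[OF ne \<psi>[of "c *\<^sub>R x"]
            tendsto_mult_left[OF \<psi>[of x], of c, folded dual_spaceD(3)[OF \<phi> that]]] .
    qed
    have C0: "C \<ge> 0" using dual_norm_nonneg[OF \<phi>, of 0] C[of 0] by linarith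
    show "dual_norm X \<psi> \<le> C"
    proof (rule dual_norm_le)
      fix x assume x: "x \<in> X" "supnorm x \<le> 1"
      show "\<bar>\<psi> x\<bar> \<le> C" using \<psi>_bound[OF x(1)] mult_left_mono[OF x(2) C0] by simp
    qed
  qed
qed

text \<open>The vectors \<open>y n\<close> act on the dual by evaluation; their pointwise limit lies
  in the bidual ball, although it need not come from a vector of \<open>X\<close>.\<close>

lemma bidual_limit:
  assumes U: "bounded_limit_filter U" and y: "\<And>n. y n \<in> X" "\<And>n. supnorm (y n) \<le> 1"
  obtains \<Psi> where "\<Psi> \<in> bidual_ball X" "\<And>\<phi>. \<phi> \<in> dual_space X \<Longrightarrow> ((\<lambda>n. \<phi> (y n)) \<longlongrightarrow> \<Psi> \<phi>) U"
proof -
  have ne: "U \<noteq> bot" using U by (simp add: bounded_limit_filter_def)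
  have "\<exists>l. \<phi> \<in> dual_space X \<longrightarrow> ((\<lambda>n. \<phi> (y n)) \<longlongrightarrow> l) U" for \<phi>
  proof (cases "\<phi> \<in> dual_space X")
    case True
    then have "bounded (range (\<lambda>n. \<phi> (y n)))"
      using abs_le_dual_norm[OF True y] by (auto simp: bounded_iff)
    then show ?thesis using U by (auto simp: bounded_limit_filter_def)
  qed simp
  then obtain \<Psi> where \<Psi>: "\<And>\<phi>. \<phi> \<in> dual_space X \<Longrightarrow> ((\<lambda>n. \<phi> (y n)) \<longlongrightarrow> \<Psi> \<phi>) U" by metis
  have "\<Psi> (\<phi> + \<psi>) = \<Psi> \<phi> + \<Psi> \<psi>" if "\<phi> \<in> dual_space X" "\<psi> \<in> dual_space X" for \<phi> \<psi>
    using tendsto_unique[OF ne \<Psi>[OF dual_space_add[OF that]]]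
      tendsto_add[OF \<Psi>[OF that(1)] \<Psi>[OF that(2)]] by simp
  moreover have "\<Psi> (c *\<^sub>R \<phi>) = c * \<Psi> \<phi>" if "\<phi> \<in> dual_space X" for \<phi> c
    using tendsto_unique[OF ne \<Psi>[OF dual_space_scaleR[OF that, of c]]]
      tendsto_mult_left[OF \<Psi>[OF that], of c] by simp
  moreover have "\<bar>\<Psi> \<phi>\<bar> \<le> dual_norm X \<phi>" if "\<phi> \<in> dual_space X" for \<phi>
    using tendsto_abs_le[OF ne \<Psi>[OF that] abs_le_dual_norm[OF that y]] .
  ultimately have "\<Psi> \<in> bidual_ball X"
    unfolding bidual_ball_def plus_fun_def scaleR_fun_def real_scaleR_def by blast
  then show thesis using that \<Psi> by blast
qed

text \<open>Take \<open>y\<close> nearly norming \<open>H\<close> and \<open>z\<close> nearly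
  norming \<open>w n\<close>. Cutting from \<open>z\<close> its part \<open>v\<close> on the finite
  set where \<open>y\<close> is not small makes \<open>y + (z - v)\<close> almost a unit vector, on
  which \<open>G n\<close> nearly attains the sum of the two norms.\<close>

lemma dual_norm_add_weak_star_null:
  assumes U: "bounded_limit_filter U" and s: "s \<in> dual_space X"
    and w: "\<And>n. w n \<in> dual_space X" and C: "\<And>n. dual_norm X (w n) \<le> C"
    and null: "\<And>x. x \<in> X \<Longrightarrow> ((\<lambda>n. w n x) \<longlongrightarrow> 0) U" and "e > 0"
  shows "eventually (\<lambda>n. dual_norm X s + dual_norm X (w n) - e \<le> dual_norm X (s + w n)) U"
proof -
  let ?W = "c0 UNIV :: ('a \<Rightarrow> real) set"
  interpret W: c0_subspace ?W by unfold_locales (auto simp: subspace_c0)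
  have ne: "U \<noteq> bot" using U by (simp add: bounded_limit_filter_def)
  have sw: "s + w n \<in> dual_space X" for n using dual_space_add[OF s w] .
  define D where "D = dual_norm X s + C"
  have D: "dual_norm X (s + w n) \<le> D" for n
    using dual_norm_add_le[OF s w[of n]] C[of n] by (simp add: D_def)
  have D0: "D \<ge> 0" using dual_norm_nonneg[OF sw, of 0] D[of 0] by linarith
  have "\<exists>G. G \<in> dual_space ?W \<and> dual_norm ?W G \<le> dual_norm X (s + w n) \<and>
      (\<forall>x\<in>X. G x = (s + w n) x)" for n
    using dual_extension[OF sw[of n]] by metis
  then obtain G where G: "\<And>n. G n \<in> dual_space ?W"
    and G_norm: "\<And>n. dual_norm ?W (G n) \<le> dual_norm X (s + w n)"
    and G_ext: "\<And>n x. x \<in> X \<Longrightarrow> G n x = s x + w n x" by (metis plus_fun_apply)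
  have GD: "dual_norm ?W (G n) \<le> D" for n using G_norm[of n] D[of n] by linarith
  obtain H where H: "H \<in> dual_space ?W" and HD: "dual_norm ?W H \<le> D"
    and H_lim: "\<And>x. ((\<lambda>n. G n x) \<longlongrightarrow> H x) U"
    using W.dual_limit[where \<phi> = G, OF U G GD] by blast
  have H_ext: "H x = s x" if "x \<in> X" for x
  proof (rule tendsto_unique[OF ne H_lim])
    show "((\<lambda>n. G n x) \<longlongrightarrow> s x) U"
      using tendsto_add[OF tendsto_const null[OF that], of "s x"] by (simp add: G_ext that)
  qed
  have sH: "dual_norm X s \<le> dual_norm ?W H"
  proof (rule dual_norm_le)
    fix x assume x: "x \<in> X" "supnorm x \<le> 1"
    show "\<bar>s x\<bar> \<le> dual_norm ?W H" using W.abs_le_dual_norm[OF H in_c0] x H_ext by metis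
  qed
  \<comment> \<open>The total loss below is \<open>5 * \<eta> + 2 * \<eta> * D\<close>: two
    \<open>\<eta>\<close> from evaluating \<open>G n\<close> at \<open>y\<close>, three from
    evaluating it at \<open>z - v\<close>, one \<open>\<eta> * D\<close> from
    \<open>H (z - v)\<close> and one from the norm bound \<open>1 + \<eta>\<close>.\<close>
  define \<eta> where "\<eta> = e / (6 + 2 * D)"
  have "\<eta> * (6 + 2 * D) = e" using D0 by (simp add: \<eta>_def)
  moreover have "\<eta> > 0" using \<open>e > 0\<close> D0 by (simp add: \<eta>_def)
  ultimately have \<eta>: "\<eta> > 0" "6 * \<eta> + 2 * (\<eta> * D) = e" by (auto simp: algebra_simps)
  obtain y where y: "y \<in> ?W" "supnorm y \<le> 1" "H y \<ge> dual_norm ?W H - \<eta>"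
    using W.dual_norm_approx[OF H \<eta>(1)] by blast
  define F where "F = {\<gamma>. \<eta> \<le> \<bar>y \<gamma>\<bar>}"
  have finF: "finite F" using y(1) \<eta>(1) by (simp add: F_def c0_def)
  define u :: "'a \<Rightarrow> 'a \<Rightarrow> real" where "u \<gamma> = (\<lambda>\<beta>. if \<beta> = \<gamma> then 1 else 0)" for \<gamma>
  have u: "u \<gamma> \<in> ?W" for \<gamma>
  proof -
    have "{\<beta>. e \<le> \<bar>u \<gamma> \<beta>\<bar>} \<subseteq> {\<gamma>}" if "e > 0" for e using that by (auto simp: u_def)
    then show ?thesis unfolding c0_def using finite_subset by blast
  qed
  \<comment> \<open>The vector \<open>v\<close> chosen later depends on \<open>n\<close>.
    Convergence on the finitely many unit vectors over \<open>F\<close> makes \<open>G n - H\<close>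
    small uniformly on unit-ball vectors supported in \<open>F\<close>.\<close>
  have "((\<lambda>n. \<Sum>\<gamma>\<in>F. \<bar>G n (u \<gamma>) - H (u \<gamma>)\<bar>) \<longlongrightarrow> (\<Sum>\<gamma>\<in>F. \<bar>H (u \<gamma>) - H (u \<gamma>)\<bar>)) U"
    by (intro tendsto_intros H_lim)
  then have "eventually (\<lambda>n. (\<Sum>\<gamma>\<in>F. \<bar>G n (u \<gamma>) - H (u \<gamma>)\<bar>) < \<eta>) U"
    by (rule order_tendstoD) (use \<eta> in simp)
  moreover have "eventually (\<lambda>n. G n y > H y - \<eta>) U"
    by (rule order_tendstoD[OF H_lim]) (use \<eta> in simp)
  ultimately show ?thesis
  proof eventually_elim
    case (elim n)
    obtain z where z: "z \<in> X" "supnorm z \<le> 1" "w n z \<ge> dual_norm X (w n) - \<eta>"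
      using dual_norm_approx[OF w \<eta>(1), of n] by blast
    have zW: "z \<in> ?W" using z(1) by (rule in_c0)
    define v where "v = (\<Sum>\<gamma>\<in>F. z \<gamma> *\<^sub>R u \<gamma>)"
    have v: "v \<in> ?W"
      unfolding v_def by (intro subspace_sum[OF W.subspace] subspace_scale[OF W.subspace] u)
    have v_apply: "v \<beta> = (if \<beta> \<in> F then z \<beta> else 0)" for \<beta>
    proof -
      have "v \<beta> = (\<Sum>\<gamma>\<in>F. if \<beta> = \<gamma> then z \<gamma> else 0)"
        by (auto simp: v_def sum_fun_apply u_def intro!: sum.cong)
      then show ?thesis using finF by simp
    qed
    have zv: "z - v \<in> ?W" using subspace_diff[OF W.subspace zW v] .
    \<comment> \<open>On \<open>F\<close> the vector \<open>z - v\<close> vanishes; off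
      \<open>F\<close> it equals \<open>z\<close> while \<open>y\<close> is below
      \<open>\<eta>\<close>. Both signs are used: the difference tests \<open>H\<close>, the sum
      tests \<open>G n\<close>.\<close>
    have small: "\<bar>y \<beta>\<bar> + \<bar>(z - v) \<beta>\<bar> \<le> 1 + \<eta>" for \<beta>
      using abs_le_supnorm[OF zW, of \<beta>] abs_le_supnorm[OF y(1), of \<beta>] z(2) y(2) \<eta>(1)
      by (auto simp: v_apply F_def)
    have plus: "supnorm (y + (z - v)) \<le> 1 + \<eta>"
    proof (rule supnorm_le)
      show "\<bar>(y + (z - v)) \<beta>\<bar> \<le> 1 + \<eta>" for \<beta> using small[of \<beta>] by simp
    qed
    have minus: "supnorm (y - (z - v)) \<le> 1 + \<eta>"
    proof (rule supnorm_le)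
      show "\<bar>(y - (z - v)) \<beta>\<bar> \<le> 1 + \<eta>" for \<beta> using small[of \<beta>] by simp
    qed
    have diff: "\<phi> (a - b) = \<phi> a - \<phi> b" if "\<phi> \<in> dual_space ?W" "a \<in> ?W" "b \<in> ?W" for \<phi> a b
      using dual_spaceD(2)[OF that(1) subspace_diff[OF W.subspace that(2,3)] that(3)] by simp
    \<comment> \<open>\<open>H\<close> almost attains its norm at \<open>y\<close>, hence is small on vectors almost disjoint from \<open>y\<close>.\<close>
    have "H y - H (z - v) \<le> dual_norm ?W H * (1 + \<eta>)"
      using W.abs_le_dual_norm_mult[OF H subspace_diff[OF W.subspace y(1) zv] minus] \<eta>(1)
        diff[OF H y(1) zv] by simp
    moreover have "dual_norm ?W H * \<eta> \<le> D * \<eta>" using HD \<eta>(1) by simp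
    ultimately have H_zv: "H (z - v) \<ge> - \<eta> - D * \<eta>"
      using y(3) by (simp add: distrib_left)
    have "\<bar>G n v - H v\<bar> = \<bar>\<Sum>\<gamma>\<in>F. z \<gamma> * (G n (u \<gamma>) - H (u \<gamma>))\<bar>"
      unfolding v_def W.dual_sum[OF G u] W.dual_sum[OF H u]
      by (simp add: sum_subtractf right_diff_distrib)
    also have "\<dots> \<le> (\<Sum>\<gamma>\<in>F. \<bar>z \<gamma> * (G n (u \<gamma>) - H (u \<gamma>))\<bar>)" by (rule sum_abs)
    also have "\<dots> \<le> (\<Sum>\<gamma>\<in>F. \<bar>G n (u \<gamma>) - H (u \<gamma>)\<bar>)"
    proof (rule sum_mono)
      fix \<gamma>
      have "\<bar>z \<gamma>\<bar> \<le> 1" using abs_le_supnorm[OF zW, of \<gamma>] z(2) by linarith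
      then show "\<bar>z \<gamma> * (G n (u \<gamma>) - H (u \<gamma>))\<bar> \<le> \<bar>G n (u \<gamma>) - H (u \<gamma>)\<bar>"
        unfolding abs_mult by (rule mult_left_le_one_le[OF abs_ge_zero abs_ge_zero])
    qed
    finally have Gv: "\<bar>G n v - H v\<bar> < \<eta>" using elim by linarith
    have "G n z - H z = w n z" using G_ext H_ext z(1) by simp
    then have "G n (z - v) \<ge> - \<eta> - D * \<eta> + (dual_norm X (w n) - \<eta>) - \<eta>"
      using H_zv Gv z(3) diff[OF G zW v] diff[OF H zW v] by (simp add: abs_less_iff)
    then have "G n (y + (z - v)) \<ge> dual_norm X s + dual_norm X (w n) - 5 * \<eta> - D * \<eta>"
      using elim(2) y(3) sH dual_spaceD(2)[OF G y(1) zv, of n] by simp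
    moreover have "G n (y + (z - v)) \<le> dual_norm ?W (G n) * (1 + \<eta>)"
      using W.abs_le_dual_norm_mult[OF G subspace_add[OF W.subspace y(1) zv] plus, of n] \<eta>(1) by simp
    moreover have "dual_norm ?W (G n) * (1 + \<eta>) \<le> dual_norm X (s + w n) + D * \<eta>"
      unfolding distrib_left mult_1_right
      using G_norm[of n] mult_right_mono[OF GD[of n], of \<eta>] \<eta>(1) by linarith
    ultimately show ?case using \<eta> by (simp add: mult.commute)
  qed
qed

section \<open>Selection of indices and the limit functional in the bidual ball\<close>

lemma bidual_almost_norming_infinitely_often:
  fixes d :: "nat \<Rightarrow> ('a \<Rightarrow> real) \<Rightarrow> real"
  assumes d: "\<And>n. d n \<in> dual_space X" and C: "\<And>n. dual_norm X (d n) \<le> C"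
    and c: "\<And>n. c \<le> dual_norm X (d n)" and "e > 0"
  obtains \<Psi> where "\<Psi> \<in> bidual_ball X" "\<And>m. \<exists>n\<ge>m. \<Psi> (d n) \<ge> c - e"
proof -
  obtain U where U: "bounded_limit_filter U"
    using exists_bounded_limit_filter by blast
  then have ne: "U \<noteq> bot" and le: "U \<le> sequentially" by (auto simp: bounded_limit_filter_def)
  have ev_gt: "eventually (\<lambda>n. n > m) U" for m
    using filter_leD[OF le eventually_gt_at_top] .
  obtain h where h: "h \<in> dual_space X" and lim: "\<And>x. ((\<lambda>n. d n x) \<longlongrightarrow> h x) U"
    using dual_limit[where \<phi> = d, OF U d C] by blast
  define w where "w n = d n - h" for n
  have w: "w n \<in> dual_space X" for n unfolding w_def using dual_space_diff[OF d h] .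
  have wC: "dual_norm X (w n) \<le> C + dual_norm X h" for n
    unfolding w_def using dual_norm_diff_le[OF d h, of n] C[of n] by linarith
  have null: "((\<lambda>n. w n x) \<longlongrightarrow> 0) U" for x
    using tendsto_diff[OF lim tendsto_const[of "h x"], of x] by (simp add: w_def)
  have step: "\<exists>n>m. dual_norm X s + dual_norm X (w n) - \<epsilon> \<le> dual_norm X (s + w n)"
    if "s \<in> dual_space X" "\<epsilon> > 0" for s m \<epsilon>
    using eventually_happens'[OF ne eventually_conj[OF ev_gt
          dual_norm_add_weak_star_null[where w = w, OF U that(1) w wC null that(2)]]] .
  \<comment> \<open>A state is a pair of a partial sum and the index added last, starting from
    \<open>h\<close>. Step \<open>j\<close> may lose \<open>e / 2 * (1 / 2) ^ Suc j\<close>, so all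
    losses together stay below \<open>e / 2\<close>.\<close>
  define P where "P j p \<longleftrightarrow> fst p \<in> dual_space X \<and> (j = 0 \<longrightarrow> fst p = h)"
    for j :: nat and p :: "(('a \<Rightarrow> real) \<Rightarrow> real) \<times> nat"
  define Q where "Q j p q \<longleftrightarrow> snd p < snd q \<and> fst q = fst p + w (snd q) \<and>
      dual_norm X (fst p) + dual_norm X (w (snd q)) - e / 2 * (1 / 2) ^ Suc j \<le> dual_norm X (fst q)"
    for j :: nat and p q :: "(('a \<Rightarrow> real) \<Rightarrow> real) \<times> nat"
  have "\<exists>f. \<forall>j. P j (f j) \<and> Q j (f j) (f (Suc j))"
  proof (rule dependent_nat_choice)
    show "\<exists>p. P 0 p" using h by (auto simp: P_def)
    fix p j assume "P j p"
    then have p: "fst p \<in> dual_space X" by (simp add: P_def)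
    obtain n where n: "n > snd p" "dual_norm X (fst p) + dual_norm X (w n) - e / 2 * (1 / 2) ^ Suc j
        \<le> dual_norm X (fst p + w n)"
      using step[OF p, of "e / 2 * (1 / 2) ^ Suc j" "snd p"] \<open>e > 0\<close> by auto
    show "\<exists>q. P (Suc j) q \<and> Q j p q"
    proof (intro exI conjI)
      show "P (Suc j) (fst p + w n, n)" using dual_space_add[OF p w] by (simp add: P_def)
      show "Q j p (fst p + w n, n)" using n by (simp add: Q_def)
    qed
  qed
  then obtain f where f: "\<And>j. P j (f j)" "\<And>j. Q j (f j) (f (Suc j))" by blast
  define S where "S j = fst (f j)" for j
  \<comment> \<open>The shift is due to \<open>f 0\<close>, whose sum \<open>h\<close> contains no
    selected term and whose index only bounds the first choice from below.\<close>
  define M where "M j = snd (f (Suc j))" for j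
  have S: "S j \<in> dual_space X" and S0: "S 0 = h" for j
    using f(1)[of j] f(1)[of 0] by (auto simp: P_def S_def)
  have S_Suc: "S (Suc j) = S j + w (M j)"
    and S_norm: "dual_norm X (S j) + dual_norm X (w (M j)) - e / 2 * (1 / 2) ^ Suc j
      \<le> dual_norm X (S (Suc j))" for j
    using f(2)[of j] by (auto simp: Q_def S_def M_def)
  have "M j < M (Suc j)" for j using f(2)[of "Suc j"] by (simp add: Q_def M_def)
  then have "strict_mono M" by (simp add: strict_mono_Suc_iff)
  then have M_ge: "M m \<ge> m" for m by (rule strict_mono_imp_increasing)
  have S_apply: "S k x = h x + (\<Sum>j<k. w (M j) x)" for k x
    by (induction k) (simp_all add: S0 S_Suc)
  have S_lower: "dual_norm X h + (\<Sum>j<k. dual_norm X (w (M j))) - e / 2 * (1 - (1 / 2) ^ k)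
      \<le> dual_norm X (S k)" for k
  proof (induction k)
    case (Suc k)
    have "e / 2 * (1 - (1 / 2) ^ Suc k) = e / 2 * (1 - (1 / 2) ^ k) + e / 2 * (1 / 2) ^ Suc k"
      by (simp add: algebra_simps)
    then show ?case using Suc S_norm[of k] unfolding sum.lessThan_Suc by linarith
  qed (simp add: S0)
  have "\<exists>y. y \<in> X \<and> supnorm y \<le> 1 \<and> S k y \<ge> dual_norm X (S k) - e / 2" for k
    using dual_norm_approx[OF S, of "e / 2" k] \<open>e > 0\<close> by (metis half_gt_zero)
  then obtain y where y: "\<And>k. y k \<in> X" "\<And>k. supnorm (y k) \<le> 1"
    "\<And>k. S k (y k) \<ge> dual_norm X (S k) - e / 2" by metis
  \<comment> \<open>At \<open>y k\<close> the sum is within \<open>e\<close> of the sum of all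
    norms, and no term exceeds its norm. Hence \<open>h\<close> and \<open>w (M j)\<close> together
    fall short of their norms by at most \<open>e\<close>, and these norms add up to at least that
    of \<open>d (M j)\<close>.\<close>
  have y_lower: "d (M j) (y k) \<ge> c - e" if "j < k" for j k
  proof -
    have "(\<Sum>i<k. w (M i) (y k)) = w (M j) (y k) + (\<Sum>i\<in>{..<k} - {j}. w (M i) (y k))"
      "(\<Sum>i<k. dual_norm X (w (M i))) =
        dual_norm X (w (M j)) + (\<Sum>i\<in>{..<k} - {j}. dual_norm X (w (M i)))"
      using that by (simp_all add: sum.remove)
    moreover have "(\<Sum>i\<in>{..<k} - {j}. w (M i) (y k)) \<le> (\<Sum>i\<in>{..<k} - {j}. dual_norm X (w (M i)))"
      using abs_le_dual_norm[OF w y(1,2)] by (intro sum_mono) (simp add: abs_le_iff)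
    moreover have "dual_norm X (d (M j)) \<le> dual_norm X h + dual_norm X (w (M j))"
      using dual_norm_add_le[OF h w[of "M j"]] by (simp add: w_def)
    moreover have "e / 2 * (1 - (1 / 2) ^ k) \<le> e / 2 * 1"
      using \<open>e > 0\<close> by (intro mult_left_mono) auto
    moreover have "d (M j) (y k) = h (y k) + w (M j) (y k)" by (simp add: w_def)
    ultimately show ?thesis
      using y(3)[of k] S_lower[of k] S_apply[of k "y k"] c[of "M j"] by linarith
  qed
  obtain \<Psi> where \<Psi>: "\<Psi> \<in> bidual_ball X"
    "\<And>\<phi>. \<phi> \<in> dual_space X \<Longrightarrow> ((\<lambda>n. \<phi> (y n)) \<longlongrightarrow> \<Psi> \<phi>) U"
    using bidual_limit[where y = y, OF U y(1,2)] by blast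
  show thesis
  proof (rule that[OF \<Psi>(1)])
    fix m
    \<comment> \<open>For fixed \<open>m\<close> the bound holds for all \<open>k > m\<close>, so
      the single limit \<open>\<Psi>\<close> inherits it for every selected index.\<close>
    have "eventually (\<lambda>k. c - e \<le> d (M m) (y k)) U"
      using ev_gt[of m] by eventually_elim (rule y_lower)
    then have "c - e \<le> \<Psi> (d (M m))"
      using tendsto_lowerbound[OF \<Psi>(2)[OF d] _ ne] by blast
    then show "\<exists>n\<ge>m. \<Psi> (d n) \<ge> c - e" using M_ge by blast
  qed
qed

end

section \<open>The Schur inequality\<close>

theorem theorem1p1:
  fixes \<Gamma> :: "'a set" and X :: "('a \<Rightarrow> real) set"
    and xs :: "nat \<Rightarrow> ('a \<Rightarrow> real) \<Rightarrow> real"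
  assumes "closed_subspace_c0 \<Gamma> X"
    and "\<forall>k. xs k \<in> dual_space X"
    and "\<exists>B. \<forall>k. dual_norm X (xs k) \<le> B"
  shows "ca_dual X xs \<le> 1 * delta_dual X xs"
proof -
  interpret c0_subspace X
  proof
    show "subspace X"
      using assms(1)
      by (auto simp: closed_subspace_c0_def subspace_def plus_fun_def zero_fun_def scaleR_fun_def)
    show "X \<subseteq> c0 UNIV" using assms(1) c0_mono[of \<Gamma> UNIV] by (auto simp: closed_subspace_c0_def)
  qed
  have xs: "xs k \<in> dual_space X" for k using assms(2) by blast
  obtain B where B: "\<And>k. dual_norm X (xs k) \<le> B" using assms(3) by blast
  have diff: "xs k - xs l \<in> dual_space X" for k l using dual_space_diff[OF xs xs] .
  have diff_le: "dual_norm X (xs k - xs l) \<le> 2 * B" for k l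
    using dual_norm_diff_le[OF xs xs, of k l] B[of k] B[of l] by linarith
  define I :: "nat \<Rightarrow> (nat \<times> nat) set" where "I n = {(k, l). n \<le> k \<and> n \<le> l}" for n
  have I: "(n, n) \<in> I n" for n by (simp add: I_def)
  then have I_ne: "I n \<noteq> {}" for n by blast
  define D where "D n = (SUP p\<in>I n. dual_norm X (xs (fst p) - xs (snd p)))" for n
  have ca: "ca_dual X xs = (INF n. D n)"
    by (simp add: ca_dual_def D_def I_def fun_diff_def)
  \<comment> \<open>The estimates for real suprema and infima rely on bounds: \<open>2 * B\<close>
    from above and 0 from below serve throughout.\<close>
  have D_bdd: "bdd_above ((\<lambda>p. dual_norm X (xs (fst p) - xs (snd p))) ` I n)" for n
    using diff_le by (intro bdd_aboveI2)
  have D_nonneg: "D n \<ge> 0" for n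
    unfolding D_def by (rule cSUP_upper2[OF D_bdd I dual_norm_nonneg[OF diff]])
  define E where "E \<Psi> n = (SUP p\<in>I n. \<bar>\<Psi> (xs (fst p)) - \<Psi> (xs (snd p))\<bar>)"
    for \<Psi> :: "(('a \<Rightarrow> real) \<Rightarrow> real) \<Rightarrow> real" and n
  have delta: "delta_dual X xs = (SUP \<Psi>\<in>bidual_ball X. INF n. E \<Psi> n)"
    by (simp add: delta_dual_def E_def I_def)
  have bidual: "\<Psi> (\<phi> - \<psi>) = \<Psi> \<phi> - \<Psi> \<psi>" "\<bar>\<Psi> \<phi>\<bar> \<le> dual_norm X \<phi>"
    if "\<Psi> \<in> bidual_ball X" "\<phi> \<in> dual_space X" "\<psi> \<in> dual_space X" for \<Psi> \<phi> \<psi>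
  proof -
    have add: "\<Psi> (\<phi>' + \<psi>) = \<Psi> \<phi>' + \<Psi> \<psi>" if "\<phi>' \<in> dual_space X" for \<phi>'
      using \<open>\<Psi> \<in> bidual_ball X\<close> that \<open>\<psi> \<in> dual_space X\<close> by (simp add: bidual_ball_def plus_fun_def)
    show "\<Psi> (\<phi> - \<psi>) = \<Psi> \<phi> - \<Psi> \<psi>" using add[OF dual_space_diff[OF that(2,3)]] by simp
    show "\<bar>\<Psi> \<phi>\<bar> \<le> dual_norm X \<phi>" using that by (simp add: bidual_ball_def)
  qed
  have E_le: "\<bar>\<Psi> (xs k) - \<Psi> (xs l)\<bar> \<le> 2 * B" if "\<Psi> \<in> bidual_ball X" for \<Psi> k l
    using bidual(1)[OF that xs xs, of k l] bidual(2)[OF that diff diff, of k l] diff_le[of k l]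
    by linarith
  have E_bdd: "bdd_above ((\<lambda>p. \<bar>\<Psi> (xs (fst p)) - \<Psi> (xs (snd p))\<bar>) ` I n)"
    if "\<Psi> \<in> bidual_ball X" for \<Psi> n
    using E_le[OF that] by (intro bdd_aboveI2)
  have E_nonneg: "E \<Psi> n \<ge> 0" if "\<Psi> \<in> bidual_ball X" for \<Psi> n
    unfolding E_def using cSUP_upper2[OF E_bdd[OF that] I, of 0] by simp
  have delta_bdd: "bdd_above ((\<lambda>\<Psi>. INF n. E \<Psi> n) ` bidual_ball X)"
  proof (rule bdd_aboveI2)
    fix \<Psi> assume \<Psi>: "\<Psi> \<in> bidual_ball X"
    have "(INF n. E \<Psi> n) \<le> E \<Psi> 0"
      using E_nonneg[OF \<Psi>] by (intro cINF_lower bdd_belowI2) auto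
    also have "\<dots> \<le> 2 * B" unfolding E_def using E_le[OF \<Psi>] by (intro cSUP_least I_ne)
    finally show "(INF n. E \<Psi> n) \<le> 2 * B" .
  qed
  have "ca_dual X xs \<le> delta_dual X xs"
  proof (rule field_le_epsilon)
    fix e :: real assume "e > 0"
    \<comment> \<open>Half of \<open>e\<close> is spent on choosing pairs that nearly realise the
      diameter of each tail, the other half on the bidual functional.\<close>
    have "\<exists>k l. n \<le> k \<and> n \<le> l \<and> ca_dual X xs - e / 2 \<le> dual_norm X (xs k - xs l)" for n
    proof -
      have "ca_dual X xs \<le> D n"
        unfolding ca using D_nonneg by (intro cINF_lower bdd_belowI2) auto
      then have "ca_dual X xs - e / 2 < D n" using \<open>e > 0\<close> by simp
      then obtain p where "p \<in> I n" "ca_dual X xs - e / 2 < dual_norm X (xs (fst p) - xs (snd p))"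
        unfolding D_def less_cSUP_iff[OF I_ne D_bdd] by blast
      then show ?thesis by (cases p) (auto simp: I_def intro!: less_imp_le)
    qed
    then obtain k l where kl: "\<And>n. n \<le> k n" "\<And>n. n \<le> l n"
      "\<And>n. ca_dual X xs - e / 2 \<le> dual_norm X (xs (k n) - xs (l n))" by metis
    obtain \<Psi> where \<Psi>: "\<Psi> \<in> bidual_ball X"
      and inf: "\<And>m. \<exists>n\<ge>m. \<Psi> (xs (k n) - xs (l n)) \<ge> ca_dual X xs - e / 2 - e / 2"
      using bidual_almost_norming_infinitely_often[where d = "\<lambda>n. xs (k n) - xs (l n)",
          OF diff diff_le kl(3) half_gt_zero[OF \<open>e > 0\<close>]] by blast
    \<comment> \<open>Good indices \<open>n\<close> occur beyond every \<open>m\<close>, and then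
      both \<open>k n\<close> and \<open>l n\<close> are at least \<open>m\<close>; so each tail has
      a large diameter under the same \<open>\<Psi>\<close>.\<close>
    have "ca_dual X xs - e \<le> (INF n. E \<Psi> n)"
    proof (rule cINF_greatest)
      fix m
      obtain n where n: "n \<ge> m" "\<Psi> (xs (k n) - xs (l n)) \<ge> ca_dual X xs - e" using inf[of m] by auto
      have "(k n, l n) \<in> I m" using n(1) kl(1,2)[of n] by (simp add: I_def)
      moreover have "ca_dual X xs - e \<le> \<bar>\<Psi> (xs (k n)) - \<Psi> (xs (l n))\<bar>"
        using n(2) bidual(1)[OF \<Psi> xs xs] by (metis abs_ge_self order_trans)
      ultimately show "ca_dual X xs - e \<le> E \<Psi> m"
        unfolding E_def by (intro cSUP_upper2[OF E_bdd[OF \<Psi>]]) auto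
    qed simp
    also have "\<dots> \<le> delta_dual X xs" unfolding delta using \<Psi> delta_bdd by (intro cSUP_upper)
    finally show "ca_dual X xs \<le> delta_dual X xs + e" by simp
  qed
  then show ?thesis by simp
qed

end
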